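(* Let $0<\delta<5/32$ and $0<\eta<2\delta/5$ be real parameters. Let $m$ be a square-free positive odd integer, and let $f_1,f_2,f_3:\mathbb{Z}_m^{*}\to[0,1]$ be functions satisfying \[ \frac{1}{\phi(m)}\sum_{x\in\mathbb{Z}_m^{*}}f_1(x)>\frac58+\delta,\qquad \frac{1}{\phi(m)}\sum_{x\in\mathbb{Z}_m^{*}}f_2(x)>\frac58-\eta,\qquad \frac{1}{\phi(m)}\sum_{x\in\mathbb{Z}_m^{*}}f_3(x)>\frac58-\eta. \] Then for every $x\in\mathbb{Z}_m$ there exist $a,b,c\in\mathbb{Z}_m^{*}$ with $x=a+b+c$ such that \[ f_1(a)f_2(b)f_3(c)>0\quad\text{and}\quad f_1(a)+f_2(b)+f_3(c)>\frac32. \]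
   Context: $\mathbb{Z}_m=\mathbb{Z}/m\mathbb{Z}$, $\mathbb{Z}_m^{*}$ is its group of units (the residues coprime to $m$), and $\phi$ is Euler's totient function. *)

theory Defs
  imports "HOL-Number_Theory.Number_Theory" "HOL-Computational_Algebra.Squarefree"
begin

text \<open>
  Elements of \<open>\<int>/m\<int>\<close> are represented by \<open>{..<m}\<close> with arithmetic modulo \<open>m\<close>. Neither
  \<^const>\<open>totatives\<close> nor the units of \<^const>\<open>residue_ring\<close> give the unit residues when \<open>m = 1\<close>:
  there they are \<open>{1}\<close> and \<open>{}\<close>, whereas the trivial ring has the single unit \<open>0\<close>.
\<close>

definition unit_residues :: "nat \<Rightarrow> nat set" where
  "unit_residues m = {a \<in> {..<m}. coprime a m}"

lemma finite_unit_residues [simp]: "finite (unit_residues m)"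
  by (simp add: unit_residues_def)

lemma unit_residues_1: "unit_residues 1 = {0}"
  by (auto simp: unit_residues_def)

lemma residue_ring_1_no_units: "Units (residue_ring 1) = {}"
  by (auto simp: Units_def residue_ring_def)

lemma in_unit_residues_iff_invertible:
  "a \<in> unit_residues m \<longleftrightarrow> a < m \<and> (\<exists>b. [a * b = 1] (mod m))"
  by (auto simp: unit_residues_def coprime_iff_invertible_nat)

lemma card_unit_residues: "card (unit_residues m) = totient m"
proof (cases "m \<le> 1")
  case True
  then have "m = 0 \<or> m = 1" by linarith
  then show ?thesis by (auto simp: unit_residues_def)
next
  case False
  then have "unit_residues m = totatives m"
    by (auto simp: unit_residues_def totatives_def le_less intro: gr0I)
  then show ?thesis by (simp add: totient_def)
qed

end

theory Submission
  imports Defs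
begin

text \<open>
  Call a triple of reals admissible if \<open>s = a + b + c\<close> and \<open>z = min a (min b c)\<close> satisfy
  \<open>s > 3/2\<close> and \<open>s + 4 z > 2\<close>. Taking means over the fibres of the Chinese remainder
  isomorphism reduces the problem to one prime factor at a time, each turning a condition on the
  three means into a condition on three values: the prime 3 (treated first) leads from the given
  densities to an admissible triple, a prime \<open>p \<ge> 7\<close> from admissible means to admissible values, and
  the prime 5 (treated last) from admissible means to positive values of sum above \<open>3/2\<close>.

  For \<open>p \<ge> 5\<close> list the values of each function in decreasing order. By Cauchy--Davenport every
  residue is a sum \<open>a + b + c\<close> of units whose values are at least the \<open>i\<close>-th, \<open>j\<close>-th and \<open>k\<close>-th
  (counting from 0), as soon as \<open>i + j + k \<ge> p - 1\<close>. What remains concerns decreasing sequences only.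
\<close>

section \<open>Sums of three sets modulo a prime\<close>

lemma inj_on_add_mod: "inj_on (\<lambda>x. (x + e) mod p) {..<p}" for p e :: nat
  by (rule inj_onI) (metis cong_def cong_add_rcancel_nat lessThan_iff mod_less)

text \<open>
  Dyson's transform replaces \<open>A\<close>, \<open>B\<close> by \<open>A \<union> (B + e)\<close>, \<open>B \<inter> (A - e)\<close>. If it never shrinks \<open>B\<close> to a
  nonempty proper subset, then \<open>A\<close> is invariant under translation by the differences of \<open>B\<close>.
\<close>

lemma cauchy_davenport:
  fixes p :: nat
  assumes p: "prime p" and "A \<subseteq> {..<p}" "A \<noteq> {}" "B \<subseteq> {..<p}" "B \<noteq> {}"
  shows "min p (card A + card B - 1) \<le> card ((\<lambda>(a, b). (a + b) mod p) ` (A \<times> B))"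
  using assms(2-)
proof (induction "card B" arbitrary: A B rule: less_induct)
  case less
  define T where "T e = (\<lambda>b. (b + e) mod p) ` B" for e
  have p0: "p > 0" using p prime_gt_0_nat by blast
  have fin: "finite A" "finite B"
    using less.prems(1,3) finite_subset[OF _ finite_lessThan] by blast+
  have T: "T e \<subseteq> {..<p}" "card (T e) = card B" for e
    using p0 inj_on_subset[OF inj_on_add_mod less.prems(3)] by (auto simp: T_def card_image)
  show ?case
  proof (cases "\<exists>e. T e \<inter> A \<noteq> {} \<and> \<not> T e \<subseteq> A")
    case True
    then obtain e where e: "T e \<inter> A \<noteq> {}" "\<not> T e \<subseteq> A" by blast
    define A' where "A' = A \<union> T e"
    define B' where "B' = {b \<in> B. (b + e) mod p \<in> A}"
    have T_A: "T e \<inter> A = (\<lambda>b. (b + e) mod p) ` B'" by (auto simp: T_def B'_def)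
    have B': "B' \<subseteq> B" "B' \<noteq> {}" using e(1) by (auto simp: B'_def T_def)
    moreover have "B' \<noteq> B" using e(2) by (auto simp: B'_def T_def)
    ultimately have lt: "card B' < card B" by (meson fin(2) psubsetI psubset_card_mono)
    have "card (T e \<inter> A) = card B'"
      unfolding T_A by (rule card_image) (use inj_on_subset[OF inj_on_add_mod] B'(1) less.prems(3) in blast)
    then have sum: "card A' + card B' = card A + card B"
      using card_Un_Int[of A "T e"] fin T by (auto simp: A'_def Int_commute T_def)
    have "(\<lambda>(a, b). (a + b) mod p) ` (A' \<times> B') \<subseteq> (\<lambda>(a, b). (a + b) mod p) ` (A \<times> B)"
    proof clarify
      fix a b assume ab: "a \<in> A'" "b \<in> B'"
      show "(a + b) mod p \<in> (\<lambda>(a, b). (a + b) mod p) ` (A \<times> B)"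
      proof (cases "a \<in> A")
        case True
        then show ?thesis using ab B' by (intro image_eqI[where x = "(a, b)"]) auto
      next
        case False
        then obtain b' where b': "b' \<in> B" "a = (b' + e) mod p" using ab by (auto simp: A'_def T_def)
        \<comment> \<open>The shift \<open>e\<close> passes from \<open>b'\<close> to
          \<open>b\<close>: since \<open>b\<close> lies in \<open>B'\<close>, the shifted
          \<open>b\<close> is in \<open>A\<close>, and \<open>b'\<close> is left in
          \<open>B\<close>.\<close>
        have "(a + b) mod p = ((b + e) mod p + b') mod p"
          unfolding b' by (simp add: mod_simps ac_simps)
        moreover have "(b + e) mod p \<in> A" using ab by (simp add: B'_def)
        ultimately show ?thesis using b' by (intro image_eqI[where x = "((b + e) mod p, b')"]) auto
      qed
    qed
    then have "card ((\<lambda>(a, b). (a + b) mod p) ` (A' \<times> B')) \<le> card ((\<lambda>(a, b). (a + b) mod p) ` (A \<times> B))"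
      by (rule card_mono[rotated]) (use fin in simp)
    moreover have "min p (card A' + card B' - 1) \<le> card ((\<lambda>(a, b). (a + b) mod p) ` (A' \<times> B'))"
      by (rule less.hyps) (use lt less.prems B' T in \<open>auto simp: A'_def\<close>)
    ultimately show ?thesis using sum by simp
  next
    case False
    obtain b where b: "b \<in> B" "b < p" using less.prems by auto
    have inj_b: "inj_on (\<lambda>a. (a + b) mod p) A"
      by (rule inj_on_subset[OF inj_on_add_mod less.prems(1)])
    then have "card A = card ((\<lambda>a. (a + b) mod p) ` A)" by (simp add: card_image)
    also have "\<dots> \<le> card ((\<lambda>(a, b). (a + b) mod p) ` (A \<times> B))"
      by (intro card_mono) (use fin b in auto)
    finally have card_A: "card A \<le> card ((\<lambda>(a, b). (a + b) mod p) ` (A \<times> B))" .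
    show ?thesis
    proof (cases "B = {b}")
      case True
      then show ?thesis using card_A by simp
    next
      case False
      then obtain b' where b': "b' \<in> B" "b' \<noteq> b" using b by blast
      then have "b' < p" using less.prems by auto
      \<comment> \<open>\<open>d\<close> represents the nonzero difference \<open>b' - b\<close>
        modulo \<open>p\<close>.\<close>
      define d where "d = b' + (p - b)"
      have "\<not> [d = 0] (mod p)"
      proof
        assume "[d = 0] (mod p)"
        then have "[d + b = b] (mod p)" using cong_add_rcancel_0_nat by (metis add.commute)
        moreover have "d + b = b' + p" using b by (simp add: d_def)
        ultimately have "[b' = b] (mod p)" by (simp add: cong_def)
        then show False using b b' \<open>b' < p\<close> cong_less_modulus_unique_nat by blast
      qed
      then have cop: "coprime d p"
        using p by (metis cong_0_iff coprime_commute prime_imp_coprime_nat)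
      have closed: "(a + d) mod p \<in> A" if "a \<in> A" for a
      proof -
        \<comment> \<open>Translation by \<open>a - b\<close> carries \<open>b\<close> to
          \<open>a\<close>, so the translate of \<open>B\<close> meets \<open>A\<close> and
          therefore lies in \<open>A\<close>. It carries \<open>b'\<close> to
          \<open>a + d\<close>.\<close>
        have "(b + (a + (p - b))) mod p = a" using b that less.prems by auto
        then have "T (a + (p - b)) \<inter> A \<noteq> {}" using b that by (auto simp: T_def)
        then have "T (a + (p - b)) \<subseteq> A" using \<open>\<nexists>e. _ e\<close> by blast
        then show ?thesis using b' by (auto simp: T_def d_def ac_simps)
      qed
      obtain a where a: "a \<in> A" "a < p" using less.prems by auto
      have orbit: "(a + k * d) mod p \<in> A" for k
      proof (induction k)
        case (Suc k)
        have "((a + k * d) mod p + d) mod p = (a + Suc k * d) mod p"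
          by (simp add: mod_simps ac_simps)
        then show ?case using closed[OF Suc.IH] by simp
      qed (use a in simp)
      \<comment> \<open>As \<open>d\<close> is invertible modulo \<open>p\<close>, some number of
        steps of length \<open>d\<close> leads from \<open>a\<close> to \<open>y\<close>; with
        \<open>i\<close> the inverse of \<open>d\<close>, that number is
        \<open>i * (y - a)\<close>.\<close>
      have "y \<in> A" if "y < p" for y
      proof -
        obtain i where i: "[d * i = 1] (mod p)" using cong_solve_coprime_nat[OF cop] by auto
        have "[a + (i * (y + (p - a))) * d = a + (y + (p - a)) * (d * i)] (mod p)"
          by (simp add: cong_def ac_simps)
        also have "[a + (y + (p - a)) * (d * i) = a + (y + (p - a)) * 1] (mod p)"
          using i by (intro cong_add cong_mult) auto
        also have "a + (y + (p - a)) * 1 = y + p" using a by simp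
        finally have "(a + (i * (y + (p - a))) * d) mod p = y" using that by (simp add: cong_def)
        then show ?thesis using orbit by metis
      qed
      then have "A = {..<p}" using less.prems by auto
      then show ?thesis using card_A by simp
    qed
  qed
qed

text \<open>By Cauchy-Davenport, \<open>X + Y\<close> (that is, \<open>?S\<close>) has at least
  \<open>min p (card X + card Y - 1)\<close> elements, and \<open>x - Z\<close> (that is,
  \<open>?T\<close>) has \<open>card Z\<close>. Together these exceed \<open>p\<close>, so the two
  sets meet.\<close>

lemma three_sets_cover:
  fixes p x :: nat
  assumes p: "prime p" and X: "X \<subseteq> {..<p}" "X \<noteq> {}" and Y: "Y \<subseteq> {..<p}" "Y \<noteq> {}"
    and Z: "Z \<subseteq> {..<p}" "Z \<noteq> {}" and card: "p + 2 \<le> card X + card Y + card Z"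
  shows "\<exists>a\<in>X. \<exists>b\<in>Y. \<exists>c\<in>Z. [x = a + b + c] (mod p)"
proof -
  let ?S = "(\<lambda>(a, b). (a + b) mod p) ` (X \<times> Y)"
  let ?T = "(\<lambda>c. (x + (p - c)) mod p) ` Z"
  have p0: "p > 0" using p prime_gt_0_nat by blast
  have inj: "inj_on (\<lambda>c. (x + (p - c)) mod p) Z"
  proof (rule inj_onI)
    fix c c' assume c: "c \<in> Z" "c' \<in> Z" and eq: "(x + (p - c)) mod p = (x + (p - c')) mod p"
    have lt: "c < p" "c' < p" using c Z by auto
    have "[x + (p - c) = x + (p - c')] (mod p)" using eq by (simp add: cong_def)
    \<comment> \<open>Adding \<open>c + c'\<close> clears both natural subtractions.\<close>
    then have "[(x + (p - c)) + (c + c') = (x + (p - c')) + (c + c')] (mod p)"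
      by (rule cong_add) simp
    then have "[(x + p) + c' = (x + p) + c] (mod p)" using lt by (simp add: ac_simps)
    then show "c = c'" using lt cong_add_lcancel_nat cong_less_modulus_unique_nat cong_sym by blast
  qed
  have fin: "finite X" "finite Y" "finite Z" using X Y Z finite_subset[OF _ finite_lessThan] by blast+
  have cZ: "card Z > 0" using Z fin by (simp add: card_gt_0_iff)
  have "p < card ?S + card ?T"
    using cauchy_davenport[OF p X Y] card cZ by (simp add: card_image[OF inj] min_def split: if_splits)
  moreover have "card (?S \<union> ?T) \<le> p"
  proof -
    have "?S \<union> ?T \<subseteq> {..<p}" using p0 by auto
    then show ?thesis using card_mono[of "{..<p}" "?S \<union> ?T"] by simp
  qed
  ultimately have "?S \<inter> ?T \<noteq> {}"
    using card_Un_disjoint[of ?S ?T] fin by force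
  then obtain a b c where abc: "a \<in> X" "b \<in> Y" "c \<in> Z" "(a + b) mod p = (x + (p - c)) mod p" by auto
  have "[x + (p - c) + c = a + b + c] (mod p)" 
    by (rule cong_add) (use abc(4) in \<open>simp_all add: cong_def\<close>)
  moreover have "c < p" using abc Z by auto
  ultimately have "[x = a + b + c] (mod p)" by (simp add: cong_def)
  then show ?thesis using abc by blast
qed

section \<open>Reduction to decreasing sequences\<close>

definition weights :: "nat \<Rightarrow> (nat \<Rightarrow> real) \<Rightarrow> bool" where
  "weights n a \<longleftrightarrow> (\<forall>i<n. a i \<in> {0..1}) \<and> (\<forall>i j. i \<le> j \<longrightarrow> j < n \<longrightarrow> a j \<le> a i)"

lemma weightsD:
  assumes "weights n a"
  shows "i < n \<Longrightarrow> 0 \<le> a i" "i < n \<Longrightarrow> a i \<le> 1" "i \<le> j \<Longrightarrow> j < n \<Longrightarrow> a j \<le> a i"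
  using assms by (auto simp: weights_def)

text \<open>For \<open>n = p - 1\<close> the index condition is the Cauchy-Davenport threshold:
  counting from 0, the top segments have \<open>i + 1\<close>, \<open>j + 1\<close> and
  \<open>k + 1\<close> elements, in total at least \<open>p + 2\<close>.\<close>

definition hits :: "nat \<Rightarrow> (real \<Rightarrow> real \<Rightarrow> real \<Rightarrow> bool) \<Rightarrow>
    (nat \<Rightarrow> real) \<Rightarrow> (nat \<Rightarrow> real) \<Rightarrow> (nat \<Rightarrow> real) \<Rightarrow> bool" where
  "hits n Q a b c \<longleftrightarrow> (\<exists>i<n. \<exists>j<n. \<exists>k<n. n \<le> i + j + k \<and> Q (a i) (b j) (c k))"

lemma hits_swap:
  assumes "\<And>x y z. Q x y z \<longleftrightarrow> Q y x z" "\<And>x y z. Q x y z \<longleftrightarrow> Q x z y"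
  shows "hits n Q b a c \<Longrightarrow> hits n Q a b c" "hits n Q a c b \<Longrightarrow> hits n Q a b c"
proof -
  assume "hits n Q b a c"
  then obtain i j k where ijk: "i < n" "j < n" "k < n" "n \<le> i + j + k" "Q (b i) (a j) (c k)"
    unfolding hits_def by blast
  then have "n \<le> j + i + k" "Q (a j) (b i) (c k)" using assms(1) by (simp, blast)
  then show "hits n Q a b c" using ijk unfolding hits_def by blast
next
  assume "hits n Q a c b"
  then obtain i j k where ijk: "i < n" "j < n" "k < n" "n \<le> i + j + k" "Q (a i) (c j) (b k)"
    unfolding hits_def by blast
  then have "n \<le> i + k + j" "Q (a i) (b k) (c j)" using assms(2) by (simp, blast)
  then show "hits n Q a b c" using ijk unfolding hits_def by blast
qed

lemma decreasing_enumeration: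
  fixes f :: "'a \<Rightarrow> real"
  assumes "finite S"
  obtains e where "bij_betw e {..<card S} S" "\<And>i j. i \<le> j \<Longrightarrow> j < card S \<Longrightarrow> f (e j) \<le> f (e i)"
proof -
  obtain ys where ys: "set ys = S" "distinct ys" using finite_distinct_list assms by blast
  define xs where "xs = sort_key (\<lambda>x. - f x) ys"
  have xs: "set xs = S" "distinct xs" "sorted (map (\<lambda>x. - f x) xs)"
    using ys by (simp_all add: xs_def)
  then have len: "length xs = card S" using distinct_card by metis
  show ?thesis
  proof (rule that[of "(!) xs"])
    show "bij_betw ((!) xs) {..<card S} S" using xs len by (intro bij_betw_nth) auto
    show "f (xs ! j) \<le> f (xs ! i)" if "i \<le> j" "j < card S" for i j
      using sorted_nth_mono[OF xs(3), of i j] that len by simp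
  qed
qed

section \<open>Conditions forced from means to values\<close>

definition unit_mean :: "nat \<Rightarrow> (nat \<Rightarrow> real) \<Rightarrow> real" where
  "unit_mean m f = (\<Sum>x\<in>unit_residues m. f x) / real (totient m)"

text \<open>This is the shape of the theorem for modulus \<open>m\<close>, with the condition on the
  means and the condition on the values left open, so that the conclusion for one factor can serve
  as the hypothesis for the next.\<close>

definition forces :: "nat \<Rightarrow> (real \<Rightarrow> real \<Rightarrow> real \<Rightarrow> bool) \<Rightarrow> (real \<Rightarrow> real \<Rightarrow> real \<Rightarrow> bool) \<Rightarrow> bool" where
  "forces m P Q \<longleftrightarrow> (\<forall>f g h x.
     f \<in> unit_residues m \<rightarrow> {0..1} \<longrightarrow> g \<in> unit_residues m \<rightarrow> {0..1} \<longrightarrow> h \<in> unit_residues m \<rightarrow> {0..1} \<longrightarrow>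
     P (unit_mean m f) (unit_mean m g) (unit_mean m h) \<longrightarrow>
     (\<exists>a\<in>unit_residues m. \<exists>b\<in>unit_residues m. \<exists>c\<in>unit_residues m.
        [x = a + b + c] (mod m) \<and> Q (f a) (g b) (h c)))"

lemma forces_mono:
  assumes "forces m P Q" "\<And>a b c. P' a b c \<Longrightarrow> P a b c"
    and Q': "\<And>a b c. a \<in> {0..1} \<Longrightarrow> b \<in> {0..1} \<Longrightarrow> c \<in> {0..1} \<Longrightarrow> Q a b c \<Longrightarrow> Q' a b c"
  shows "forces m P' Q'"
  unfolding forces_def
proof (intro allI impI)
  fix f g h :: "nat \<Rightarrow> real" and x
  assume fgh: "f \<in> unit_residues m \<rightarrow> {0..1}" "g \<in> unit_residues m \<rightarrow> {0..1}" "h \<in> unit_residues m \<rightarrow> {0..1}"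
    and "P' (unit_mean m f) (unit_mean m g) (unit_mean m h)"
  then obtain a b c where abc: "a \<in> unit_residues m" "b \<in> unit_residues m" "c \<in> unit_residues m"
      "[x = a + b + c] (mod m)" "Q (f a) (g b) (h c)"
    using assms(1,2) unfolding forces_def by blast
  moreover have "Q' (f a) (g b) (h c)"
    using Q'[OF funcset_mem[OF fgh(1) abc(1)] funcset_mem[OF fgh(2) abc(2)] funcset_mem[OF fgh(3) abc(3)] abc(5)] .
  ultimately show "\<exists>a\<in>unit_residues m. \<exists>b\<in>unit_residues m. \<exists>c\<in>unit_residues m.
      [x = a + b + c] (mod m) \<and> Q' (f a) (g b) (h c)"
    by blast
qed

text \<open>Over the trivial ring a mean is the value at 0. This starts the induction over prime
  factors.\<close>

lemma forces_1: "forces 1 P P"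
proof -
  have U: "unit_residues 1 = {0}" by (rule unit_residues_1)
  then show ?thesis by (auto simp: forces_def unit_mean_def cong_def)
qed

text \<open>Cauchy-Davenport controls only that the summands come from the top segments, so the
  indices found may be smaller than those in \<open>hits\<close>. Their values are then at least as
  large, which is why \<open>Q\<close> has to be upward closed.\<close>

lemma forces_prime:
  assumes p: "prime p"
    and up: "\<And>a b c a' b' c'. Q a b c \<Longrightarrow> a \<le> a' \<Longrightarrow> b \<le> b' \<Longrightarrow> c \<le> c' \<Longrightarrow> Q a' b' c'"
    and seq: "\<And>a b c. weights (p - 1) a \<Longrightarrow> weights (p - 1) b \<Longrightarrow> weights (p - 1) c \<Longrightarrow>
      P (sum a {..<p - 1} / real (p - 1)) (sum b {..<p - 1} / real (p - 1)) (sum c {..<p - 1} / real (p - 1)) \<Longrightarrow>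
      hits (p - 1) Q a b c"
  shows "forces p P Q"
  unfolding forces_def
proof (intro allI impI)
  let ?U = "unit_residues p" and ?n = "p - 1"
  fix f g h :: "nat \<Rightarrow> real" and x
  assume f: "f \<in> ?U \<rightarrow> {0..1}" and g: "g \<in> ?U \<rightarrow> {0..1}" and h: "h \<in> ?U \<rightarrow> {0..1}"
    and P: "P (unit_mean p f) (unit_mean p g) (unit_mean p h)"
  have n: "card ?U = ?n" "totient p = ?n" using p by (simp_all add: card_unit_residues totient_prime)
  have enum: "\<exists>e. bij_betw e {..<?n} ?U \<and> weights ?n (f \<circ> e) \<and> unit_mean p f = sum (f \<circ> e) {..<?n} / real ?n"
    if "f \<in> ?U \<rightarrow> {0..1}" for f
  proof -
    obtain e where e: "bij_betw e {..<?n} ?U" "\<And>i j. i \<le> j \<Longrightarrow> j < ?n \<Longrightarrow> f (e j) \<le> f (e i)"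
      using decreasing_enumeration[of ?U f] n by auto
    have "weights ?n (f \<circ> e)"
      unfolding weights_def using e that bij_betwE[OF e(1)] by fastforce
    moreover have "sum (f \<circ> e) {..<?n} = sum f ?U"
      using sum.reindex_bij_betw[OF e(1), of f] by simp
    ultimately show ?thesis using e n by (auto simp: unit_mean_def)
  qed
  obtain e1 where e1: "bij_betw e1 {..<?n} ?U" "weights ?n (f \<circ> e1)" "unit_mean p f = sum (f \<circ> e1) {..<?n} / real ?n"
    using enum[OF f] by blast
  obtain e2 where e2: "bij_betw e2 {..<?n} ?U" "weights ?n (g \<circ> e2)" "unit_mean p g = sum (g \<circ> e2) {..<?n} / real ?n"
    using enum[OF g] by blast
  obtain e3 where e3: "bij_betw e3 {..<?n} ?U" "weights ?n (h \<circ> e3)" "unit_mean p h = sum (h \<circ> e3) {..<?n} / real ?n"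
    using enum[OF h] by blast
  obtain i j k where ijk: "i < ?n" "j < ?n" "k < ?n" "?n \<le> i + j + k" "Q (f (e1 i)) (g (e2 j)) (h (e3 k))"
    using seq[OF e1(2) e2(2) e3(2)] P e1(3) e2(3) e3(3) by (auto simp: hits_def)
  have top: "e ` {..i} \<subseteq> ?U \<and> card (e ` {..i}) = Suc i" if "bij_betw e {..<?n} ?U" "i < ?n" for e i
  proof
    show "e ` {..i} \<subseteq> ?U" using that by (force simp: bij_betw_def)
    have "inj_on e {..i}" using that by (auto simp: bij_betw_def intro: inj_on_subset)
    then show "card (e ` {..i}) = Suc i" by (simp add: card_image)
  qed
  have U: "?U \<subseteq> {..<p}" by (auto simp: unit_residues_def)
  have "\<exists>a\<in>e1 ` {..i}. \<exists>b\<in>e2 ` {..j}. \<exists>c\<in>e3 ` {..k}. [x = a + b + c] (mod p)"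
  proof (rule three_sets_cover[OF p])
    show "p + 2 \<le> card (e1 ` {..i}) + card (e2 ` {..j}) + card (e3 ` {..k})"
      using top[OF e1(1) ijk(1)] top[OF e2(1) ijk(2)] top[OF e3(1) ijk(3)] ijk(4) by simp
  qed (use top[OF e1(1) ijk(1)] top[OF e2(1) ijk(2)] top[OF e3(1) ijk(3)] U in \<open>blast+\<close>)
  then obtain i' j' k' where le: "i' \<le> i" "j' \<le> j" "k' \<le> k" and x: "[x = e1 i' + e2 j' + e3 k'] (mod p)"
    by auto
  have "Q (f (e1 i')) (g (e2 j')) (h (e3 k'))"
    using up[OF ijk(5)] e1(2) e2(2) e3(2) le ijk(1-3) by (simp add: weights_def)
  moreover have "e1 i' \<in> ?U" "e2 j' \<in> ?U" "e3 k' \<in> ?U"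
    using bij_betwE[OF e1(1)] bij_betwE[OF e2(1)] bij_betwE[OF e3(1)] le ijk by auto
  ultimately show "\<exists>a\<in>?U. \<exists>b\<in>?U. \<exists>c\<in>?U. [x = a + b + c] (mod p) \<and> Q (f a) (g b) (h c)"
    using x by blast
qed

section \<open>Products of coprime moduli\<close>

lemma bij_betw_unit_residues_mult:
  assumes "coprime m n" "m > 0" "n > 0"
  shows "bij_betw (\<lambda>z. (z mod m, z mod n)) (unit_residues (m * n)) (unit_residues m \<times> unit_residues n)"
proof (rule bij_betwI')
  fix z z' assume z: "z \<in> unit_residues (m * n)" "z' \<in> unit_residues (m * n)"
  show "((z mod m, z mod n) = (z' mod m, z' mod n)) = (z = z')"
  proof
    assume "(z mod m, z mod n) = (z' mod m, z' mod n)"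
    then have "[z = z'] (mod m * n)"
      using assms by (intro coprime_cong_mult_nat) (auto simp: cong_def)
    then show "z = z'"
      using z cong_less_modulus_unique_nat by (auto simp: unit_residues_def)
  qed simp
next
  fix z assume "z \<in> unit_residues (m * n)"
  then show "(z mod m, z mod n) \<in> unit_residues m \<times> unit_residues n"
    using assms by (auto simp: unit_residues_def coprime_mod_left_iff)
next
  fix y assume "y \<in> unit_residues m \<times> unit_residues n"
  then obtain u v where y: "y = (u, v)" "u < m" "coprime u m" "v < n" "coprime v n"
    by (auto simp: unit_residues_def)
  obtain z where z: "z < m * n" "[z = u] (mod m)" "[z = v] (mod n)"
    using binary_chinese_remainder_unique_nat[OF assms(1), of u v] assms by auto
  then have mods: "z mod m = u" "z mod n = v"
    using y by (simp_all add: cong_def)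
  then have "coprime z m" "coprime z n"
    using y assms by (metis coprime_mod_left_iff neq0_conv)+
  then have "z \<in> unit_residues (m * n)" using z by (simp add: unit_residues_def)
  then show "\<exists>z\<in>unit_residues (m * n). y = (z mod m, z mod n)" using mods y by auto
qed

lemma unit_mean_in_unit_interval:
  assumes "f \<in> unit_residues m \<rightarrow> {0..1}" "m > 0"
  shows "unit_mean m f \<in> {0..1}"
proof -
  have "sum f (unit_residues m) \<le> (\<Sum>x\<in>unit_residues m. 1)"
    using assms by (intro sum_mono) auto
  moreover have "0 \<le> sum f (unit_residues m)"
    using assms by (intro sum_nonneg) auto
  ultimately show ?thesis
    using assms by (simp add: unit_mean_def card_unit_residues divide_le_eq)
qed

text \<open>A mean modulo \<open>m * n\<close> is the mean over residues modulo \<open>m\<close> of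
  the fibre means \<open>avg\<close>. The first factor selects three fibres whose means satisfy
  \<open>Q\<close>; the second, applied to the functions on these fibres, selects values satisfying
  \<open>R\<close>. The order of the factors thus matters.\<close>

lemma forces_mult:
  assumes cop: "coprime m n" and pos: "m > 0" "n > 0" and "forces m P Q" "forces n Q R"
  shows "forces (m * n) P R"
  unfolding forces_def
proof (intro allI impI)
  let ?U = "unit_residues m" and ?V = "unit_residues n" and ?W = "unit_residues (m * n)"
  fix f g h :: "nat \<Rightarrow> real" and x
  assume f: "f \<in> ?W \<rightarrow> {0..1}" and g: "g \<in> ?W \<rightarrow> {0..1}" and h: "h \<in> ?W \<rightarrow> {0..1}"
    and P: "P (unit_mean (m * n) f) (unit_mean (m * n) g) (unit_mean (m * n) h)"
  define lift where "lift = inv_into ?W (\<lambda>z. (z mod m, z mod n))"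
  have bij: "bij_betw lift (?U \<times> ?V) ?W"
    unfolding lift_def by (rule bij_betw_inv_into[OF bij_betw_unit_residues_mult[OF cop pos]])
  have lift_W: "lift (u, v) \<in> ?W" if "u \<in> ?U" "v \<in> ?V" for u v
    using bij_betwE[OF bij] that by blast
  have lift_mod: "lift (u, v) mod m = u \<and> lift (u, v) mod n = v" if "u \<in> ?U" "v \<in> ?V" for u v
    using bij_betw_inv_into_right[OF bij_betw_unit_residues_mult[OF cop pos], of "(u, v)"] that
    by (simp add: lift_def)
  define avg where "avg f u = unit_mean n (\<lambda>v. f (lift (u, v)))" for f u
  have avg: "unit_mean (m * n) f = unit_mean m (avg f)" for f
  proof -
    have "sum f ?W = (\<Sum>u\<in>?U. \<Sum>v\<in>?V. f (lift (u, v)))"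
      by (simp add: sum.cartesian_product sum.reindex_bij_betw[OF bij, symmetric] case_prod_beta)
    then show ?thesis
      by (simp add: unit_mean_def avg_def totient_mult_coprime[OF cop] sum_divide_distrib mult.commute)
  qed
  have avg_01: "avg f \<in> ?U \<rightarrow> {0..1}" if "f \<in> ?W \<rightarrow> {0..1}" for f
    unfolding avg_def
    by (intro Pi_I unit_mean_in_unit_interval) (use that lift_W pos in auto)
  obtain a b c where abc: "a \<in> ?U" "b \<in> ?U" "c \<in> ?U" "[x = a + b + c] (mod m)"
      and Q: "Q (avg f a) (avg g b) (avg h c)"
    using \<open>forces m P Q\<close>[unfolded forces_def] avg_01[OF f] avg_01[OF g] avg_01[OF h] P[unfolded avg]
    by blast
  have "(\<lambda>v. f (lift (a, v))) \<in> ?V \<rightarrow> {0..1}" "(\<lambda>v. g (lift (b, v))) \<in> ?V \<rightarrow> {0..1}"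
      "(\<lambda>v. h (lift (c, v))) \<in> ?V \<rightarrow> {0..1}"
    using f g h lift_W abc by auto
  then obtain a' b' c' where abc': "a' \<in> ?V" "b' \<in> ?V" "c' \<in> ?V" "[x = a' + b' + c'] (mod n)"
      and R: "R (f (lift (a, a'))) (g (lift (b, b'))) (h (lift (c, c')))"
    using \<open>forces n Q R\<close>[unfolded forces_def] Q[unfolded avg_def] by blast
  let ?s = "lift (a, a') + lift (b, b') + lift (c, c')"
  have "[?s = a + b + c] (mod m)" "[?s = a' + b' + c'] (mod n)"
    using lift_mod abc abc' by (intro cong_add; simp add: cong_def unit_residues_def)+
  then have "[x = ?s] (mod m * n)"
    using abc(4) abc'(4) cong_trans cong_sym cop coprime_cong_mult_nat by meson
  then show "\<exists>a\<in>?W. \<exists>b\<in>?W. \<exists>c\<in>?W. [x = a + b + c] (mod m * n) \<and> R (f a) (g b) (h c)"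
    using R lift_W abc abc' by blast
qed

section \<open>Admissible and winning triples\<close>

text \<open>
  The factor 4 is a compromise: with 2 in its place some triples arising from the prime 3 would be
  excluded, and with 5 the system in \<open>coarse_system_infeasible\<close> below would be feasible.
\<close>

definition admissible :: "real \<Rightarrow> real \<Rightarrow> real \<Rightarrow> bool" where
  "admissible a b c \<longleftrightarrow> 3/2 < a + b + c \<and>
     2 < a + b + c + 4 * a \<and> 2 < a + b + c + 4 * b \<and> 2 < a + b + c + 4 * c"

definition winning :: "real \<Rightarrow> real \<Rightarrow> real \<Rightarrow> bool" where
  "winning a b c \<longleftrightarrow> 0 < a \<and> 0 < b \<and> 0 < c \<and> 3/2 < a + b + c"

text \<open>Since \<open>3/2 + 4 * (1/8) = 2\<close>, entries of at least \<open>1/8\<close> take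
  care of the conditions on the single entries.\<close>

lemma admissibleI:
  "3/2 < a + b + c \<Longrightarrow> 1/8 \<le> a \<Longrightarrow> 1/8 \<le> b \<Longrightarrow> 1/8 \<le> c \<Longrightarrow> admissible a b c"
  by (simp add: admissible_def)

text \<open>When the other two entries are at most 1, \<open>2 < 5 * a + b + c\<close> makes
  \<open>a\<close> positive, and likewise for \<open>b\<close> and \<open>c\<close>.\<close>

lemma admissible_imp_winning:
  "admissible a b c \<Longrightarrow> a \<le> 1 \<Longrightarrow> b \<le> 1 \<Longrightarrow> c \<le> 1 \<Longrightarrow> winning a b c"
  by (simp add: admissible_def winning_def)

lemma admissible_mono:
  "admissible a b c \<Longrightarrow> a \<le> a' \<Longrightarrow> b \<le> b' \<Longrightarrow> c \<le> c' \<Longrightarrow> admissible a' b' c'"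
  by (simp add: admissible_def)

lemma winning_mono:
  "winning a b c \<Longrightarrow> a \<le> a' \<Longrightarrow> b \<le> b' \<Longrightarrow> c \<le> c' \<Longrightarrow> winning a' b' c'"
  by (simp add: winning_def)

lemma admissible_swap: "admissible a b c \<longleftrightarrow> admissible b a c" "admissible a b c \<longleftrightarrow> admissible a c b"
  by (auto simp: admissible_def algebra_simps)

lemma winning_swap: "winning a b c \<longleftrightarrow> winning b a c" "winning a b c \<longleftrightarrow> winning a c b"
  by (auto simp: winning_def algebra_simps)

section \<open>The primes from 7 on\<close>

text \<open>
  The pairs \<open>(i, j)\<close> with \<open>i + j = n - k\<close> are averaged; for \<open>k > 0\<close> the remaining entries of both
  sequences are bounded through the pairs \<open>(n - k, 0)\<close> and \<open>(0, n - k)\<close>.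
\<close>

lemma antidiagonal_pair:
  fixes a b :: "nat \<Rightarrow> real"
  assumes a: "\<And>i j. i \<le> j \<Longrightarrow> j < n \<Longrightarrow> a j \<le> a i" and b: "\<And>i j. i \<le> j \<Longrightarrow> j < n \<Longrightarrow> b j \<le> b i"
    and k: "k < n" "1 < n"
  shows "\<exists>i<n. \<exists>j<n. i + j + k = n \<and>
    real (n + k - 1) * (a 0 + b 0 - a i - b j) \<le> real n * (a 0 + b 0) - sum a {..<n} - sum b {..<n}"
proof (rule ccontr)
  assume contra: "\<not> ?thesis"
  \<comment> \<open>These are the deficits from the largest entries, with total \<open>D\<close>. If
    every pair had deficit above \<open>l\<close>, the total would exceed \<open>D\<close>.\<close>
  define \<alpha> \<beta> where "\<alpha> i = a 0 - a i" and "\<beta> i = b 0 - b i" for i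
  define D where "D = sum \<alpha> {..<n} + sum \<beta> {..<n}"
  define l where "l = D / real (n + k - 1)"
  have D: "D = real n * (a 0 + b 0) - sum a {..<n} - sum b {..<n}"
    by (simp add: D_def \<alpha>_def \<beta>_def sum_subtractf algebra_simps)
  have N: "0 < real (n + k - 1)" using k by simp
  have big: "l < \<alpha> i + \<beta> j" if "i < n" "j < n" "i + j + k = n" for i j
  proof -
    have "\<not> real (n + k - 1) * (a 0 + b 0 - a i - b j) \<le> D"
      using contra that unfolding D by blast
    then have "D < (\<alpha> i + \<beta> j) * real (n + k - 1)"
      by (simp only: not_le \<alpha>_def \<beta>_def) (simp add: algebra_simps)
    then show ?thesis unfolding l_def by (simp only: pos_divide_less_eq[OF N])
  qed
  have zero: "\<alpha> 0 = 0" "\<beta> 0 = 0" by (simp_all add: \<alpha>_def \<beta>_def)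
  have "real (n + k - 1) * l < D"
  proof (cases "k = 0")
    case True
    \<comment> \<open>The \<open>n - 1\<close> pairs \<open>(i, n - i)\<close> use each positive
      index once in either sequence, and the deficit at index 0 vanishes.\<close>
    have "real (n - 1) * l = (\<Sum>i=1..<n. l)" by simp
    also have "\<dots> < (\<Sum>i=1..<n. \<alpha> i + \<beta> (n - i))"
      by (rule sum_strict_mono) (use k big True in auto)
    also have "\<dots> = (\<Sum>i=1..<n. \<alpha> i) + (\<Sum>i=1..<n. \<beta> (n - i))" by (rule sum.distrib)
    also have "(\<Sum>i=1..<n. \<beta> (n - i)) = (\<Sum>i=1..<n. \<beta> i)"
      by (rule sum.reindex_bij_witness[of _ "\<lambda>i. n - i" "\<lambda>i. n - i"]) auto
    also have "(\<Sum>i=1..<n. \<alpha> i) + (\<Sum>i=1..<n. \<beta> i) = D"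
      unfolding D_def lessThan_atLeast0 using k zero by (simp add: sum.atLeast_Suc_lessThan)
    finally show ?thesis using True by simp
  next
    case False
    define m where "m = n - k"
    have m: "m < n" "m + k = n" using False k by (auto simp: m_def)
    have tail: "l \<le> \<alpha> i \<and> l \<le> \<beta> i" if "i \<in> {m<..<n}" for i
    proof -
      have "\<alpha> m \<le> \<alpha> i" "\<beta> m \<le> \<beta> i" using a[of m i] b[of m i] that by (simp_all add: \<alpha>_def \<beta>_def)
      then show ?thesis using big[of m 0] big[of 0 m] zero m by force
    qed
    have split: "sum f {..<n} = sum f {..m} + sum f {m<..<n}" for f :: "nat \<Rightarrow> real"
    proof -
      have "{..<n} = {..m} \<union> {m<..<n}" using m by auto
      then show ?thesis using sum.union_disjoint[of "{..m}" "{m<..<n}" f] by (simp add: disjoint_iff)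
    qed
    \<comment> \<open>There are \<open>m + 1\<close> pairs on the antidiagonal and
      \<open>k - 1\<close> further entries in each sequence, each contributing at least
      \<open>l\<close>; the count is \<open>m + 1 + 2 * (k - 1) = n + k - 1\<close>.\<close>
    have "real (n + k - 1) * l = (\<Sum>i\<le>m. l) + (\<Sum>i\<in>{m<..<n}. l) + (\<Sum>i\<in>{m<..<n}. l)"
    proof -
      have "real (n + k - 1) = real (m + 1) + real (n - Suc m) + real (n - Suc m)" using m False by simp
      then show ?thesis by (simp add: algebra_simps)
    qed
    also have "\<dots> < (\<Sum>i\<le>m. \<alpha> i + \<beta> (m - i)) + sum \<alpha> {m<..<n} + sum \<beta> {m<..<n}"
      by (intro add_less_le_mono sum_strict_mono sum_mono) (use big tail m in auto)
    also have "(\<Sum>i\<le>m. \<alpha> i + \<beta> (m - i)) = sum \<alpha> {..m} + sum \<beta> {..m}"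
      by (simp add: sum.distrib sum.nat_diff_reindex[of \<beta> "Suc m", unfolded lessThan_Suc_atMost, simplified])
    finally show ?thesis by (simp add: D_def split)
  qed
  then show False using N by (simp add: l_def)
qed

text \<open>Repeat every entry six times and cut the resulting list of length \<open>6 * n\<close>
  into six blocks of length \<open>n\<close>. In a decreasing list each block is dominated by its
  first entry.\<close>

lemma sum_le_coarse_sum:
  fixes c :: "nat \<Rightarrow> real"
  assumes c: "\<And>i j. i \<le> j \<Longrightarrow> j < n \<Longrightarrow> c j \<le> c i"
  shows "6 * sum c {..<n} \<le> real n * (\<Sum>j<6. c (j * n div 6))"
proof -
  have "6 * sum c {..<n} = (\<Sum>k<n. \<Sum>q\<in>{k * 6..<k * 6 + 6}. c (q div 6))"
    unfolding sum_distrib_left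
  proof (rule sum.cong)
    fix k
    have "(\<Sum>q\<in>{k * 6..<k * 6 + 6}. c (q div 6)) = (\<Sum>q\<in>{k * 6..<k * 6 + 6}. c k)"
    proof (rule sum.cong)
      fix q assume "q \<in> {k * 6..<k * 6 + 6}"
      then have "q div 6 = k" by (intro div_nat_eqI) auto
      then show "c (q div 6) = c k" by simp
    qed simp
    then show "6 * c k = (\<Sum>q\<in>{k * 6..<k * 6 + 6}. c (q div 6))" by simp
  qed simp
  also have "\<dots> = (\<Sum>q<n * 6. c (q div 6))" by (rule sum.nat_group)
  also have "\<dots> = (\<Sum>q<6 * n. c (q div 6))" by (simp only: mult.commute)
  also have "\<dots> = (\<Sum>j<6. \<Sum>q\<in>{j * n..<j * n + n}. c (q div 6))" by (rule sum.nat_group[symmetric])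
  also have "\<dots> \<le> (\<Sum>j<6. \<Sum>q\<in>{j * n..<j * n + n}. c (j * n div 6))"
  proof (intro sum_mono c)
    fix j q assume jq: "j \<in> {..<6}" "q \<in> {j * n..<j * n + n}"
    then show "j * n div 6 \<le> q div 6" by (auto intro: div_le_mono)
    have "(j + 1) * n \<le> 6 * n" using jq by (intro mult_right_mono) auto
    moreover have "q < (j + 1) * n" using jq by simp
    ultimately have "q < 6 * n" by linarith
    then show "q div 6 < n" by simp
  qed
  also have "\<dots> = real n * (\<Sum>j<6. c (j * n div 6))" by (simp add: sum_distrib_left)
  finally show ?thesis .
qed

lemma disj3E: "P \<or> Q \<or> R \<Longrightarrow> (P \<Longrightarrow> S) \<Longrightarrow> (Q \<Longrightarrow> S) \<Longrightarrow> (R \<Longrightarrow> S) \<Longrightarrow> S"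
  by blast

text \<open>
  Here \<open>\<alpha>\<close>, \<open>\<beta>\<close>, \<open>d 0\<close> are the largest entries of the three sequences, \<open>\<alpha> + \<beta> - L\<close> is the sum of
  the first two means and \<open>C\<close> is the third mean. A pair from \<open>antidiagonal_pair\<close> has sum at least
  \<open>\<alpha> + \<beta> - 6 / (5 + j) * L\<close>, so \<open>fails\<close> lists the ways in which it is not admissible together
  with \<open>d j\<close>. The order of the case distinctions was found by a search for a small refutation tree.
\<close>

lemma coarse_system_infeasible:
  fixes \<alpha> \<beta> L C :: real and d :: "nat \<Rightarrow> real"
  assumes tops: "\<alpha> \<le> 1" "\<beta> \<le> \<alpha>" "d 0 \<le> \<beta>"
    and decr: "\<And>i j. i \<le> j \<Longrightarrow> j < 6 \<Longrightarrow> d j \<le> d i"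
    and L: "0 \<le> L" and C: "6 * C \<le> (\<Sum>j<6. d j)"
    and S: "3/2 < \<alpha> + \<beta> - L + C" "2 < \<alpha> + \<beta> - L + 5 * C"
    and fails: "\<And>j. j < 6 \<Longrightarrow> \<alpha> + \<beta> - 6 / (5 + real j) * L + d j \<le> 3/2 \<or>
      \<alpha> + \<beta> - 6 / (5 + real j) * L + 5 * d j \<le> 2 \<or> \<alpha> + 5 * \<beta> - 30 / (5 + real j) * L + d j \<le> 2"
  shows False
proof -
  have ord: "d 1 \<le> d 0" "d 2 \<le> d 1" "d 3 \<le> d 2" "d 4 \<le> d 3" "d 5 \<le> d 4"
    by (rule decr; simp)+
  have "(\<Sum>j<6. d j) = d 0 + d 1 + d 2 + d 3 + d 4 + d 5" by (simp add: eval_nat_numeral)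
  then have C': "6 * C \<le> d 0 + d 1 + d 2 + d 3 + d 4 + d 5" using C by simp
  have n0: "\<alpha> + \<beta> - 6/5 * L + d 0 \<le> 3/2 \<or> \<alpha> + \<beta> - 6/5 * L + 5 * d 0 \<le> 2
      \<or> \<alpha> + 5 * \<beta> - 30/5 * L + d 0 \<le> 2"
    using fails[of 0] by simp
  have n1: "\<alpha> + \<beta> - 6/6 * L + d 1 \<le> 3/2 \<or> \<alpha> + \<beta> - 6/6 * L + 5 * d 1 \<le> 2
      \<or> \<alpha> + 5 * \<beta> - 30/6 * L + d 1 \<le> 2"
    using fails[of 1] by simp
  have n2: "\<alpha> + \<beta> - 6/7 * L + d 2 \<le> 3/2 \<or> \<alpha> + \<beta> - 6/7 * L + 5 * d 2 \<le> 2
      \<or> \<alpha> + 5 * \<beta> - 30/7 * L + d 2 \<le> 2"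
    using fails[of 2] by simp
  have n3: "\<alpha> + \<beta> - 6/8 * L + d 3 \<le> 3/2 \<or> \<alpha> + \<beta> - 6/8 * L + 5 * d 3 \<le> 2
      \<or> \<alpha> + 5 * \<beta> - 30/8 * L + d 3 \<le> 2"
    using fails[of 3] by simp
  have n4: "\<alpha> + \<beta> - 6/9 * L + d 4 \<le> 3/2 \<or> \<alpha> + \<beta> - 6/9 * L + 5 * d 4 \<le> 2
      \<or> \<alpha> + 5 * \<beta> - 30/9 * L + d 4 \<le> 2"
    using fails[of 4] by simp
  note R1 = L C' S ord and R2 = tops C' S(1) ord
  show False
    by (rule disj3E[OF n4], rule disj3E[OF n0], rule disj3E[OF n3], use R1 in linarith,
      use R1 in linarith, use R2 in linarith, use R1 in linarith, rule disj3E[OF n1],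
      rule disj3E[OF n2], use R2 in linarith, use R2 in linarith, use R2 in linarith,
      use R2 in linarith, rule disj3E[OF n2], rule disj3E[OF n3], use R2 in linarith,
      use R2 in linarith, use R2 L in linarith, use R2 in linarith, rule disj3E[OF n3],
      use R2 in linarith, use R2 in linarith, use R2 in linarith, rule disj3E[OF n3],
      rule disj3E[OF n0], use R1 in linarith, use R1 in linarith, rule disj3E[OF n1],
      rule disj3E[OF n2], use R2 in linarith, use R2 in linarith, use R2 in linarith,
      use R2 in linarith, rule disj3E[OF n2], use R2 in linarith, use R2 in linarith,
      use R2 in linarith, rule disj3E[OF n0], rule disj3E[OF n2], use R1 in linarith,
      rule disj3E[OF n1], use R1 in linarith, use R1 in linarith, use R2 in linarith,
      use R2 in linarith, use R1 in linarith, rule disj3E[OF n1], rule disj3E[OF n2],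
      use R2 in linarith, use R2 in linarith, use R2 in linarith, use R2 in linarith,
      rule disj3E[OF n2], use R2 in linarith, use R2 in linarith, use R2 in linarith,
      use R2 in linarith, use R2 in linarith)
qed

text \<open>
  The pairs taken from the two sequences with the larger first entries are combined with the entry
  of the third at index \<open>j * n div 6\<close>, where \<open>j < 6\<close>. For \<open>n \<ge> 10\<close> the bounds on these pairs are
  at least as good as for \<open>n = 6\<close>.
\<close>

lemma admissible_sequences_sorted:
  assumes n: "n = 6 \<or> 10 \<le> n" and w: "weights n a" "weights n b" "weights n c"
    and tops: "c 0 \<le> b 0" "b 0 \<le> a 0"
    and adm: "admissible (sum a {..<n} / real n) (sum b {..<n} / real n) (sum c {..<n} / real n)"
  shows "hits n admissible a b c"
proof (rule ccontr)
  assume contra: "\<not> ?thesis"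
  define L where "L = a 0 + b 0 - sum a {..<n} / real n - sum b {..<n} / real n"
  define d where "d j = c (j * n div 6)" for j
  have n0: "0 < n" using n by auto
  have mean_le: "sum f {..<n} / real n \<le> f 0" if "weights n f" for f
  proof -
    have "sum f {..<n} \<le> (\<Sum>i<n. f 0)" using that by (intro sum_mono) (auto simp: weights_def)
    then show ?thesis using n0 by (simp add: divide_le_eq mult.commute)
  qed
  have L0: "0 \<le> L" using mean_le[OF w(1)] mean_le[OF w(2)] by (simp add: L_def)
  have lt: "j * n div 6 < n" if "j < 6" for j
  proof -
    have "j * n < 6 * n" using that n0 by simp
    then show ?thesis by (simp add: less_mult_imp_div_less mult.commute)
  qed
  have d: "d j \<le> d i" if "i \<le> j" "j < 6" for i j
    unfolding d_def by (intro weightsD(3)[OF w(3)] div_le_mono lt) (use that in auto)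
  have "6 * sum c {..<n} \<le> real n * (\<Sum>j<6. d j)"
    unfolding d_def by (rule sum_le_coarse_sum) (rule weightsD(3)[OF w(3)])
  then have C: "6 * (sum c {..<n} / real n) \<le> (\<Sum>j<6. d j)"
    using n0 by (simp add: divide_le_eq mult.commute)
  have fails: "a 0 + b 0 - 6 / (5 + real j) * L + d j \<le> 3/2 \<or>
      a 0 + b 0 - 6 / (5 + real j) * L + 5 * d j \<le> 2 \<or>
      a 0 + 5 * b 0 - 30 / (5 + real j) * L + d j \<le> 2" if j: "j < 6" for j
  proof -
    let ?k = "j * n div 6"
    obtain i i' where i: "i < n" "i' < n" "i + i' + ?k = n"
      and pair: "real (n + ?k - 1) * (a 0 + b 0 - a i - b i')
        \<le> real n * (a 0 + b 0) - sum a {..<n} - sum b {..<n}"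
      using antidiagonal_pair[of n a b ?k] weightsD(3)[OF w(1)] weightsD(3)[OF w(2)] lt[OF j] n by auto
    have ai: "a i \<le> a 0" "b i' \<le> b 0" using w i by (auto simp: weights_def)
    \<comment> \<open>This turns the factor \<open>n / (n + ?k - 1)\<close> into
      \<open>6 / (5 + j)\<close>, with equality for \<open>n = 6\<close>. Rounding in
      \<open>?k\<close> costs at most 5, which the slack absorbs once \<open>11 \<le> n\<close>;
      \<open>n = 10\<close> is checked directly.\<close>
    have "n * (5 + j) \<le> 6 * (n + ?k - 1)"
    proof (cases "11 \<le> n")
      case True
      have "j * n \<le> 6 * ?k + 5" by presburger
      then show ?thesis using True by (simp add: algebra_simps)
    next
      case False
      then have "n = 6 \<or> n = 10" "j = 0 \<or> j = 1 \<or> j = 2 \<or> j = 3 \<or> j = 4 \<or> j = 5" using n j by auto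
      then show ?thesis by auto
    qed
    then have "real (n * (5 + j)) \<le> real (6 * (n + ?k - 1))" by (rule of_nat_mono)
    then have "real n * (5 + real j) * (a 0 + b 0 - a i - b i') \<le> 6 * real (n + ?k - 1) * (a 0 + b 0 - a i - b i')"
      using ai by (intro mult_right_mono) simp_all
    also have "\<dots> \<le> real n * (6 * L)"
      using pair n0 by (simp add: L_def algebra_simps)
    finally have "(5 + real j) * (a 0 + b 0 - a i - b i') \<le> 6 * L"
      using n0 by (simp add: mult.assoc)
    then have "a 0 + b 0 - a i - b i' \<le> 6 / (5 + real j) * L"
      by (simp add: le_divide_eq mult.commute)
    moreover have "30 / (5 + real j) * L = 5 * (6 / (5 + real j) * L)" by simp
    moreover have "\<not> admissible (a i) (b i') (d j)" using contra i lt[OF j] unfolding hits_def d_def by (metis order_refl)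
    \<comment> \<open>Failure at either of the first two entries gives the third alternative:
      weighting one entry by 5 multiplies the loss by at most 5, and
      \<open>b 0 \<le> a 0\<close>.\<close>
    ultimately show ?thesis using ai tops unfolding admissible_def by linarith
  qed
  show False
  proof (rule coarse_system_infeasible[OF _ tops(2) _ d L0 C _ _ fails])
    show "a 0 \<le> 1" using weightsD(2)[OF w(1) n0] .
    show "d 0 \<le> b 0" using tops by (simp add: d_def)
  qed (use adm in \<open>simp_all add: L_def admissible_def\<close>)
qed

lemma admissible_sequences:
  assumes n: "n = 6 \<or> 10 \<le> n" and w: "weights n a" "weights n b" "weights n c"
    and adm: "admissible (sum a {..<n} / real n) (sum b {..<n} / real n) (sum c {..<n} / real n)"
  shows "hits n admissible a b c"
proof -
  note swap = hits_swap[where Q = admissible, OF admissible_swap]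
  note sorted = admissible_sequences_sorted[OF n]
  have c_least: "hits n admissible a b c"
    if "weights n a" "weights n b" "weights n c" "c 0 \<le> b 0" "c 0 \<le> a 0"
      "admissible (sum a {..<n} / real n) (sum b {..<n} / real n) (sum c {..<n} / real n)" for a b c
  proof (cases "b 0 \<le> a 0")
    case True
    then show ?thesis using that sorted by blast
  next
    case False
    then have "hits n admissible b a c" using that sorted[of b a c] admissible_swap(1) by simp
    then show ?thesis by (rule swap(1))
  qed
  consider "c 0 \<le> a 0" "c 0 \<le> b 0" | "b 0 \<le> a 0" "b 0 \<le> c 0" | "a 0 \<le> b 0" "a 0 \<le> c 0" by linarith
  then show ?thesis
  proof cases
    case 1
    then show ?thesis using c_least w adm by blast
  next
    case 2
    then have "hits n admissible a c b" using c_least[of a c b] w adm admissible_swap(2) by blast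
    then show ?thesis by (rule swap(2))
  next
    case 3
    then have "hits n admissible b c a" using c_least[of b c a] w adm admissible_swap by blast
    then show ?thesis using swap by blast
  qed
qed

lemma forces_prime_ge_7:
  assumes p: "prime p" "7 \<le> p"
  shows "forces p admissible admissible"
proof (rule forces_prime[OF p(1)])
  have "odd p" using p prime_odd_nat by simp
  moreover have "p \<noteq> 9" 
  proof
    assume "p = 9"
    then have "3 dvd p" by simp
    then have "(3::nat) = 1 \<or> 3 = p" using p(1) unfolding prime_nat_iff by blast
    then show False using \<open>p = 9\<close> by simp
  qed
  ultimately have "p = 7 \<or> 11 \<le> p" using p(2) by presburger
  then have "p - 1 = 6 \<or> 10 \<le> p - 1" by auto
  then show "hits (p - 1) admissible a b c"
    if "weights (p - 1) a" "weights (p - 1) b" "weights (p - 1) c"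
      "admissible (sum a {..<p - 1} / real (p - 1)) (sum b {..<p - 1} / real (p - 1)) (sum c {..<p - 1} / real (p - 1))"
    for a b c
    using admissible_sequences that by blast
qed (rule admissible_mono)

section \<open>The prime 3\<close>

lemma prime_3_5: "prime (3::nat)" "prime (5::nat)"
  by (rule prime_nat_numeral_eq[THEN iffD2]; simp add: upt_rec)+

lemma unit_residues_prime:
  assumes "prime p"
  shows "unit_residues p = {1..<p}"
proof -
  have "coprime a p" if "0 < a" "a < p" for a
    using prime_imp_coprime[OF assms, of a] that nat_dvd_not_less by (auto simp: coprime_commute)
  moreover have "\<not> coprime 0 p" using assms by auto
  ultimately have "a \<in> unit_residues p \<longleftrightarrow> a \<in> {1..<p}" for a
    by (cases "a = 0") (auto simp: unit_residues_def)
  then show ?thesis by blast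
qed

lemma forces_3:
  fixes \<delta> \<eta> :: real
  assumes "0 < \<delta>" "\<delta> < 5/32" "\<eta> < 2 * \<delta> / 5"
  shows "forces 3 (\<lambda>a b c. 5/8 + \<delta> < a \<and> 5/8 - \<eta> < b \<and> 5/8 - \<eta> < c) admissible"
  unfolding forces_def
proof (intro allI impI)
  fix f g h :: "nat \<Rightarrow> real" and x
  have U: "unit_residues 3 = {1, 2}" unfolding unit_residues_prime[OF prime_3_5(1)] by auto
  have "totient 3 = 2" using prime_3_5(1) by (simp only: totient_prime)
  then have mean: "unit_mean 3 f = (f 1 + f 2) / 2" for f by (simp add: unit_mean_def U)
  assume "f \<in> unit_residues 3 \<rightarrow> {0..1}" "g \<in> unit_residues 3 \<rightarrow> {0..1}" "h \<in> unit_residues 3 \<rightarrow> {0..1}"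
  then have le1: "f 1 \<le> 1" "f 2 \<le> 1" "g 1 \<le> 1" "g 2 \<le> 1" "h 1 \<le> 1" "h 2 \<le> 1" by (auto simp: U)
  assume "5/8 + \<delta> < unit_mean 3 f \<and> 5/8 - \<eta> < unit_mean 3 g \<and> 5/8 - \<eta> < unit_mean 3 h"
  then have "5/8 + \<delta> < unit_mean 3 f" "5/8 - \<eta> < unit_mean 3 g" "5/8 - \<eta> < unit_mean 3 h"
    by simp_all
  then have m: "5/4 + 2 * \<delta> < f 1 + f 2" "5/4 - 2 * \<eta> < g 1 + g 2" "5/4 - 2 * \<eta> < h 1 + h 2"
    unfolding mean by (simp_all add: field_simps)
  \<comment> \<open>All values are at most 1, so those of \<open>g\<close> and \<open>h\<close>
    exceed \<open>1/4 - 2 * \<eta>\<close>, and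
    \<open>2 * \<eta> < 4 * \<delta> / 5 < 1/8\<close>.\<close>
  have ge: "1/8 \<le> f 1" "1/8 \<le> f 2" "1/8 \<le> g 1" "1/8 \<le> g 2" "1/8 \<le> h 1" "1/8 \<le> h 2"
    using m le1 assms by linarith+
  \<comment> \<open>One line per residue class of \<open>x\<close>; in each, the two sums add up to
    more than 3. In the second and third a value of \<open>f\<close> counts twice, and it exceeds
    \<open>1/4 + 2 * \<delta>\<close>, while \<open>g\<close> and \<open>h\<close> contribute more
    than \<open>5/2 - 4 * \<eta>\<close>.\<close>
  have sums: "3/2 < f 1 + g 1 + h 1 \<or> 3/2 < f 2 + g 2 + h 2"
    "3/2 < f 1 + g 1 + h 2 \<or> 3/2 < f 1 + g 2 + h 1"
    "3/2 < f 2 + g 2 + h 1 \<or> 3/2 < f 2 + g 1 + h 2"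
    using m ge assms le1 by linarith+
  have "\<exists>a\<in>{1, 2}. \<exists>b\<in>{1, 2}. \<exists>c\<in>{1, 2}. [x = a + b + c] (mod 3) \<and> 3/2 < f a + g b + h c"
  proof -
    have "x mod 3 < 3" by simp
    then consider "x mod 3 = 0" | "x mod 3 = 1" | "x mod 3 = 2" by linarith
    then show ?thesis using sums by cases (auto simp: cong_def)
  qed
  then obtain a b c where abc: "a \<in> unit_residues 3" "b \<in> unit_residues 3" "c \<in> unit_residues 3"
      "[x = a + b + c] (mod 3)" "3/2 < f a + g b + h c"
    unfolding U by blast
  moreover have "1/8 \<le> f a" "1/8 \<le> g b" "1/8 \<le> h c"
    using abc(1-3) ge unfolding U by auto
  ultimately show "\<exists>a\<in>unit_residues 3. \<exists>b\<in>unit_residues 3. \<exists>c\<in>unit_residues 3.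
      [x = a + b + c] (mod 3) \<and> admissible (f a) (g b) (h c)"
    using admissibleI by blast
qed

section \<open>The prime 5\<close>

text \<open>
  Once the sizes \<open>p\<close>, \<open>q\<close>, \<open>r\<close> of the supports are fixed, the negated claim is a system of linear
  inequalities. If \<open>p + q + r \<le> 6\<close>, the sum of the means is at most \<open>3/2\<close> already.
\<close>

lemma winning_sequences_4_sorted:
  assumes w: "weights 4 a" "weights 4 b" "weights 4 c"
    and supp: "\<And>i. i < 4 \<Longrightarrow> 0 < a i \<longleftrightarrow> i < p" "\<And>i. i < 4 \<Longrightarrow> 0 < b i \<longleftrightarrow> i < q"
      "\<And>i. i < 4 \<Longrightarrow> 0 < c i \<longleftrightarrow> i < r"
    and pqr: "p \<le> q" "q \<le> r" "r \<le> 4"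
    and adm: "admissible (sum a {..<4} / 4) (sum b {..<4} / 4) (sum c {..<4} / 4)"
  shows "hits 4 winning a b c"
proof (rule ccontr)
  assume contra: "\<not> ?thesis"
  \<comment> \<open>Positive entries at indices allowed by \<open>hits\<close> can fail to win only
    through their sum.\<close>
  have T: "a i + b j + c k \<le> 3/2" if "i < p" "j < q" "k < r" "4 \<le> i + j + k" for i j k
  proof -
    have "i < 4" "j < 4" "k < 4" using that pqr by auto
    then show ?thesis using contra supp that unfolding hits_def winning_def by (meson not_le)
  qed
  define A B C where "A = sum a {..<4}" and "B = sum b {..<4}" and "C = sum c {..<4}"
  have sums: "A = a 0 + a 1 + a 2 + a 3" "B = b 0 + b 1 + b 2 + b 3" "C = c 0 + c 1 + c 2 + c 3"
    by (simp_all add: A_def B_def C_def eval_nat_numeral)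
  have K: "6 < A + B + C" "8 < 5 * A + B + C"
    using adm by (simp_all add: admissible_def A_def B_def C_def field_simps)
  have tops: "a 0 \<le> 1" "b 0 \<le> 1" "c 0 \<le> 1"
    using weightsD(2)[OF w(1)] weightsD(2)[OF w(2)] weightsD(2)[OF w(3)] by simp_all
  have ord: "f 1 \<le> f 0" "f 2 \<le> f 1" "f 3 \<le> f 2" "0 \<le> f 3" if "weights 4 f" for f
    using that by (auto simp: weights_def)
  note oa = ord[OF w(1)] and ob = ord[OF w(2)] and oc = ord[OF w(3)]
  have zero: "a i = 0 \<or> i < p" "b i = 0 \<or> i < q" "c i = 0 \<or> i < r" if "i < 4" for i
    using supp[OF that] weightsD(1)[OF w(1) that] weightsD(1)[OF w(2) that] weightsD(1)[OF w(3) that]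
    by linarith+
  have size: "sum f {..<4} \<le> real s" if "weights 4 f" "\<And>i. i < 4 \<Longrightarrow> f i = 0 \<or> i < s" for f s
  proof -
    have "sum f {..<4} = sum f ({..<4} \<inter> {..<s})"
      by (rule sum.mono_neutral_right) (use that in auto)
    also have "\<dots> \<le> (\<Sum>i\<in>{..<4} \<inter> {..<s}. 1)"
      by (rule sum_mono) (use that in \<open>auto simp: weights_def\<close>)
    also have "\<dots> = real (card ({..<4} \<inter> {..<s}))" by simp
    also have "\<dots> \<le> real (card {..<s})" by (intro of_nat_mono card_mono) auto
    also have "\<dots> = real s" by simp
    finally show ?thesis .
  qed
  have "A \<le> real p" "B \<le> real q" "C \<le> real r"
    unfolding A_def B_def C_def by (rule size; use w zero in blast)+
  then have "6 < p + q + r" using K(1) by linarith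
  moreover have "0 < p"
  proof (rule ccontr)
    assume "\<not> 0 < p"
    then have "A \<le> 0" using \<open>A \<le> real p\<close> by simp
    moreover have "B \<le> 4" "C \<le> 4" using \<open>B \<le> real q\<close> \<open>C \<le> real r\<close> pqr by linarith+
    ultimately show False using K(2) by linarith
  qed
  moreover have "p = 1 \<or> p = 2 \<or> p = 3 \<or> p = 4" "q = 1 \<or> q = 2 \<or> q = 3 \<or> q = 4"
      "r = 1 \<or> r = 2 \<or> r = 3 \<or> r = 4"
    using \<open>0 < p\<close> pqr by linarith+
  \<comment> \<open>These are the 13 sorted triples from 1 to 4 with sum at least 7. In each case
    the listed inequalities are contradictory once entries beyond the supports are set to 0; the
    bound \<open>K(2)\<close> on the first sequence enters for the sizes \<open>(1, 4, 4)\<close>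
    and \<open>(2, 4, 4)\<close>.\<close>
  ultimately consider
    "p = 1" "q = 2" "r = 4"
  | "p = 1" "q = 3" "r = 3"
  | "p = 1" "q = 3" "r = 4"
  | "p = 1" "q = 4" "r = 4"
  | "p = 2" "q = 2" "r = 3"
  | "p = 2" "q = 2" "r = 4"
  | "p = 2" "q = 3" "r = 3"
  | "p = 2" "q = 3" "r = 4"
  | "p = 2" "q = 4" "r = 4"
  | "p = 3" "q = 3" "r = 3"
  | "p = 3" "q = 3" "r = 4"
  | "p = 3" "q = 4" "r = 4"
  | "p = 4" "q = 4" "r = 4"
    using pqr by (elim disjE; simp)
  then show False
  proof cases
    case 1
    with K(1) tops(2) tops(3) oc(1) oc(2) T[of 0 1 3] zero(1)[of 1] zero(1)[of 2] zero(1)[of 3]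
      zero(2)[of 2] zero(2)[of 3]
    show ?thesis by (simp add: sums del: One_nat_def; linarith)
  next
    case 2
    with K(1) tops(2) ob(1) tops(3) oc(1) T[of 0 2 2] zero(1)[of 1] zero(1)[of 2] zero(1)[of 3]
      zero(2)[of 3] zero(3)[of 3]
    show ?thesis by (simp add: sums del: One_nat_def; linarith)
  next
    case 3
    with K(1) oa(1) tops(2) tops(3) oc(1) T[of 0 1 3] T[of 0 2 2] zero(1)[of 1] zero(1)[of 2]
      zero(1)[of 3] zero(2)[of 3]
    show ?thesis by (simp add: sums del: One_nat_def; linarith)
  next
    case 4
    with K(1) K(2) tops(2) tops(3) T[of 0 1 3] T[of 0 2 2] T[of 0 3 1] zero(1)[of 1]
      zero(1)[of 2] zero(1)[of 3]
    show ?thesis by (simp add: sums del: One_nat_def; linarith)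
  next
    case 5
    with K(1) tops(1) tops(2) tops(3) oc(1) T[of 1 1 2] zero(1)[of 2] zero(1)[of 3] zero(2)[of 2]
      zero(2)[of 3] zero(3)[of 3]
    show ?thesis by (simp add: sums del: One_nat_def; linarith)
  next
    case 6
    with K(1) tops(3) oc(1) oc(2) oc(4) T[of 0 1 3] T[of 1 0 3] zero(1)[of 2] zero(1)[of 3]
      zero(2)[of 2] zero(2)[of 3]
    show ?thesis by (simp add: sums del: One_nat_def; linarith)
  next
    case 7
    with K(1) tops(2) tops(3) oc(1) oc(3) T[of 0 2 2] T[of 1 1 2] zero(1)[of 2] zero(1)[of 3]
      zero(2)[of 3] zero(3)[of 3]
    show ?thesis by (simp add: sums del: One_nat_def; linarith)
  next
    case 8
    with K(1) tops(2) tops(3) oc(1) oc(3) T[of 0 2 2] T[of 1 1 2] zero(1)[of 2] zero(1)[of 3]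
      zero(2)[of 3]
    show ?thesis by (simp add: sums del: One_nat_def; linarith)
  next
    case 9
    with K(1) K(2) tops(2) tops(3) T[of 0 1 3] T[of 0 2 2] T[of 0 3 1] T[of 1 0 3] T[of 1 1 2]
      T[of 1 2 1] T[of 1 3 0] zero(1)[of 2] zero(1)[of 3]
    show ?thesis by (simp add: sums del: One_nat_def; linarith)
  next
    case 10
    with K(1) tops(2) ob(3) tops(3) oc(3) T[of 0 2 2] T[of 1 1 2] T[of 1 2 1] T[of 2 1 1]
      T[of 2 2 0] zero(1)[of 3] zero(2)[of 3] zero(3)[of 3]
    show ?thesis by (simp add: sums del: One_nat_def; linarith)
  next
    case 11
    with K(1) tops(3) T[of 0 2 2] T[of 1 0 3] T[of 2 1 1] zero(1)[of 3] zero(2)[of 3]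
    show ?thesis by (simp add: sums del: One_nat_def; linarith)
  next
    case 12
    with K(1) oa(3) oc(3) T[of 0 3 1] T[of 1 1 2] T[of 2 0 2] T[of 2 2 0] zero(1)[of 3]
    show ?thesis by (simp add: sums del: One_nat_def; linarith)
  next
    case 13
    with K(1) oc(2) oc(3) T[of 0 3 1] T[of 1 2 1] T[of 2 0 2] T[of 3 1 0]
    show ?thesis by (simp add: sums del: One_nat_def; linarith)
  qed
qed

text \<open>In a decreasing sequence the positive entries form an initial segment.\<close>

lemma weights_support:
  assumes "weights n a"
  obtains p where "p \<le> n" "\<And>i. i < n \<Longrightarrow> 0 < a i \<longleftrightarrow> i < p"
proof
  let ?S = "{i. i < n \<and> 0 < a i}"
  have down: "j \<in> ?S" if "i \<in> ?S" "j \<le> i" for i j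
    using weightsD(3)[OF assms, of j i] that by auto
  have "?S = {..<card ?S}"
  proof (cases "?S = {}")
    case False
    have "finite ?S" by simp
    then have "Max ?S \<in> ?S" using False by (rule Max_in)
    then have "?S = {..Max ?S}" using down Max_ge[OF \<open>finite ?S\<close>] by blast
    then have "?S = {..<Suc (Max ?S)}" by (simp only: lessThan_Suc_atMost)
    then show ?thesis by (metis card_lessThan)
  next
    case True
    then show ?thesis by (simp only: card.empty lessThan_0)
  qed
  then show "0 < a i \<longleftrightarrow> i < card ?S" if "i < n" for i using that by blast
  show "card ?S \<le> n" using card_mono[of "{..<n}" ?S] by auto
qed

lemma winning_sequences_4:
  assumes w: "weights 4 a" "weights 4 b" "weights 4 c"
    and adm: "admissible (sum a {..<4} / 4) (sum b {..<4} / 4) (sum c {..<4} / 4)"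
  shows "hits 4 winning a b c"
proof -
  note swap = hits_swap[where Q = winning, OF winning_swap]
  obtain p where p: "p \<le> 4" "\<And>i. i < 4 \<Longrightarrow> 0 < a i \<longleftrightarrow> i < p" using weights_support[OF w(1)] by blast
  obtain q where q: "q \<le> 4" "\<And>i. i < 4 \<Longrightarrow> 0 < b i \<longleftrightarrow> i < q" using weights_support[OF w(2)] by blast
  obtain r where r: "r \<le> 4" "\<And>i. i < 4 \<Longrightarrow> 0 < c i \<longleftrightarrow> i < r" using weights_support[OF w(3)] by blast
  note sorted = winning_sequences_4_sorted
  consider "p \<le> q" "q \<le> r" | "p \<le> r" "r \<le> q" | "q \<le> p" "p \<le> r" | "q \<le> r" "r \<le> p"
    | "r \<le> p" "p \<le> q" | "r \<le> q" "q \<le> p" by linarith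
  then show ?thesis
  proof cases
    case 1
    show ?thesis by (rule sorted[OF w(1,2,3) p(2) q(2) r(2) 1 r(1) adm])
  next
    case 2
    have "hits 4 winning a c b"
      by (rule sorted[OF w(1,3,2) p(2) r(2) q(2) 2 q(1)]) (use adm admissible_swap in blast)+
    then show ?thesis using swap by blast
  next
    case 3
    have "hits 4 winning b a c"
      by (rule sorted[OF w(2,1,3) q(2) p(2) r(2) 3 r(1)]) (use adm admissible_swap in blast)+
    then show ?thesis using swap by blast
  next
    case 4
    have "hits 4 winning b c a"
      by (rule sorted[OF w(2,3,1) q(2) r(2) p(2) 4 p(1)]) (use adm admissible_swap in blast)+
    then show ?thesis using swap by blast
  next
    case 5
    have "hits 4 winning c a b"
      by (rule sorted[OF w(3,1,2) r(2) p(2) q(2) 5 q(1)]) (use adm admissible_swap in blast)+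
    then show ?thesis using swap by blast
  next
    case 6
    have "hits 4 winning c b a"
      by (rule sorted[OF w(3,2,1) r(2) q(2) p(2) 6 p(1)]) (use adm admissible_swap in blast)+
    then show ?thesis using swap by blast
  qed
qed

text \<open>The conclusion is weaker than admissibility, so no further factor can be chained after
  5.\<close>

lemma forces_5: "forces 5 admissible winning"
proof (rule forces_prime)
  show "prime (5::nat)" by (rule prime_3_5)
  show "hits (5 - 1) winning a b c"
    if "weights (5 - 1) a" "weights (5 - 1) b" "weights (5 - 1) c"
      "admissible (sum a {..<5 - 1} / real (5 - 1)) (sum b {..<5 - 1} / real (5 - 1)) (sum c {..<5 - 1} / real (5 - 1))"
    for a b c
    using winning_sequences_4[of a b c] that by simp
qed (rule winning_mono)

section \<open>Square-free moduli\<close>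

lemma squarefree_prime_split:
  fixes m p :: nat
  assumes "squarefree m" "prime p" "p dvd m"
  obtains n where "m = p * n" "coprime p n" "squarefree n"
proof -
  obtain n where n: "m = p * n" using assms by blast
  have "\<not> p dvd n"
  proof
    assume "p dvd n"
    then have "p ^ 2 dvd m" by (simp add: n power2_eq_square)
    then show False using squarefreeD[OF assms(1)] assms(2) not_prime_unit by blast
  qed
  then have "coprime p n" using assms prime_imp_coprime by blast
  moreover have "squarefree n" using assms n squarefree_mono dvd_triv_right by blast
  ultimately show ?thesis using that n by blast
qed

text \<open>Prime factors, all at least 7, are split off one at a time; admissibility is both
  hypothesis and conclusion at each of them, so any number can be chained.\<close>

lemma forces_coprime_30:
  assumes "squarefree m" "coprime m 30"
  shows "forces m admissible admissible"
  using assms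
proof (induction m rule: less_induct)
  case (less m)
  have m0: "m > 0" using less.prems(1) by (auto intro: gr0I)
  show ?case
  proof (cases "m = 1")
    case True
    then show ?thesis using forces_1 by simp
  next
    case False
    then obtain p where p: "prime p" "p dvd m" using prime_factor_nat by blast
    then obtain n where n: "m = p * n" "coprime p n" "squarefree n"
      using squarefree_prime_split less.prems(1) by blast
    have "p > 1" "n > 0" using p m0 n prime_gt_1_nat by auto
    have cop: "coprime p 30" "coprime n 30" using less.prems(2) n by simp_all
    have "p \<noteq> 2" "p \<noteq> 3" "p \<noteq> 5" 
    proof -
      have "\<not> p dvd 30" using cop(1) p(1) coprime_absorb_left not_prime_unit by blast
      then show "p \<noteq> 2" "p \<noteq> 3" "p \<noteq> 5" by auto
    qed
    moreover have "p \<noteq> 4" "p \<noteq> 6" using p(1) prime_odd_nat[of p] by auto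
    ultimately have "7 \<le> p" using \<open>p > 1\<close> by linarith
    then have "forces p admissible admissible" using p forces_prime_ge_7 by blast
    moreover have "forces n admissible admissible"
      using less.IH[of n] n cop \<open>p > 1\<close> \<open>n > 0\<close> by simp
    ultimately show ?thesis using forces_mult n \<open>p > 1\<close> \<open>n > 0\<close> by simp
  qed
qed

lemma forces_not_3_dvd:
  assumes "squarefree m" "odd m" "\<not> 3 dvd m"
  shows "forces m admissible winning"
proof -
  have base: "forces n admissible admissible" if "squarefree n" "odd n" "\<not> 3 dvd n" "\<not> 5 dvd n" for n
  proof -
    have "coprime 2 n" "coprime 3 n" "coprime 5 n"
      using that prime_imp_coprime[OF prime_3_5(1), of n] prime_imp_coprime[OF prime_3_5(2), of n]
      by (simp_all add: coprime_left_2_iff_odd)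
    then have "coprime n (2 * 3 * 5)"
      by (simp only: coprime_mult_right_iff coprime_commute simp_thms)
    then show ?thesis using forces_coprime_30 that(1) by simp
  qed
  show ?thesis
  proof (cases "5 dvd m")
    case False
    then have "forces m admissible admissible" using base assms by blast
    then show ?thesis by (rule forces_mono) (auto intro: admissible_imp_winning)
  next
    case True
    then obtain n where n: "m = 5 * n" "coprime 5 n" "squarefree n"
      using squarefree_prime_split[OF assms(1) prime_3_5(2)] by blast
    have "\<not> 5 dvd n" using n(2) prime_3_5(2) coprime_absorb_left not_prime_unit by blast
    moreover have "\<not> 3 dvd n" using assms(3) unfolding n(1) by (blast intro: dvd_mult)
    moreover have "odd n" using assms(2) by (simp add: n(1))
    ultimately have "forces n admissible admissible" using base n(3) by blast
    moreover have "n > 0" using n(3) by (auto intro: gr0I)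
    \<comment> \<open>The factor 5 is written last because it only delivers
      \<open>winning\<close>.\<close>
    ultimately have "forces (n * 5) admissible winning"
      using n(2) forces_5 by (intro forces_mult) (simp_all add: coprime_commute)
    then show ?thesis by (simp only: n(1) mult.commute)
  qed
qed

theorem theorem1p3:
  fixes \<delta> \<eta> :: real and m :: nat and f\<^sub>1 f\<^sub>2 f\<^sub>3 :: "nat \<Rightarrow> real"
  assumes "0 < \<delta>" "\<delta> < 5 / 32"
    and "0 < \<eta>" "\<eta> < 2 * \<delta> / 5"
    and "squarefree m" "m > 0" "odd m"
    and "f\<^sub>1 \<in> unit_residues m \<rightarrow> {0..1}"
    and "f\<^sub>2 \<in> unit_residues m \<rightarrow> {0..1}"
    and "f\<^sub>3 \<in> unit_residues m \<rightarrow> {0..1}"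
    and "1 / real (totient m) * (\<Sum>x\<in>unit_residues m. f\<^sub>1 x) > 5 / 8 + \<delta>"
    and "1 / real (totient m) * (\<Sum>x\<in>unit_residues m. f\<^sub>2 x) > 5 / 8 - \<eta>"
    and "1 / real (totient m) * (\<Sum>x\<in>unit_residues m. f\<^sub>3 x) > 5 / 8 - \<eta>"
  shows "\<forall>x<m. \<exists>a\<in>unit_residues m. \<exists>b\<in>unit_residues m. \<exists>c\<in>unit_residues m.
           [x = a + b + c] (mod m) \<and>
           f\<^sub>1 a * f\<^sub>2 b * f\<^sub>3 c > 0 \<and> f\<^sub>1 a + f\<^sub>2 b + f\<^sub>3 c > 3 / 2"
proof -
  define dense where "dense a b c \<longleftrightarrow> 5/8 + \<delta> < a \<and> 5/8 - \<eta> < b \<and> 5/8 - \<eta> < c" for a b c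
  have "forces m dense winning"
  proof (cases "3 dvd m")
    case False
    \<comment> \<open>Here \<open>\<eta> < 1/16\<close> and \<open>2 * \<eta> < \<delta>\<close>, so
      each mean exceeds \<open>1/8\<close> and their sum exceeds \<open>15/8\<close>.\<close>
    have "dense a b c \<Longrightarrow> admissible a b c" for a b c
      unfolding dense_def using assms(1-4) by (intro admissibleI) linarith+
    then show ?thesis
      using forces_mono[OF forces_not_3_dvd[OF assms(5,7) False]] by blast
  next
    case True
    then obtain n where n: "m = 3 * n" "coprime 3 n" "squarefree n"
      using squarefree_prime_split[OF assms(5) prime_3_5(1)] by blast
    have "\<not> 3 dvd n" using n(2) prime_3_5(1) coprime_absorb_left not_prime_unit by blast
    then have "forces n admissible winning" using forces_not_3_dvd n assms(7) by simp
    moreover have "forces 3 dense admissible"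
      unfolding dense_def using forces_3[OF assms(1,2,4)] .
    moreover have "n > 0" using n(1) assms(6) by simp
    ultimately show ?thesis unfolding n(1) using n(2) by (intro forces_mult) simp_all
  qed
  moreover have "dense (unit_mean m f\<^sub>1) (unit_mean m f\<^sub>2) (unit_mean m f\<^sub>3)"
    using assms(11-13) by (simp add: dense_def unit_mean_def)
  ultimately have "\<exists>a\<in>unit_residues m. \<exists>b\<in>unit_residues m. \<exists>c\<in>unit_residues m.
      [x = a + b + c] (mod m) \<and> winning (f\<^sub>1 a) (f\<^sub>2 b) (f\<^sub>3 c)" for x
    using assms(8-10) unfolding forces_def by blast
  then show ?thesis
    unfolding winning_def by (meson mult_pos_pos)
qed

end
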